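(* Let $a\ge 3$ be an integer, let $\rho$ be a root of the polynomial $x^3+(a-1)x^2-ax-1$, and let $\alpha$ be an indecomposable integer in $\mathbb Z[\rho]$ which is not a unit. Then \[ \min_{\delta\in\mathbb Z[\rho]^{\vee,+}}\mathrm{Tr}(\alpha\delta)=2 . \]
   Context: The field $K=\mathbb Q(\rho)$ is a totally real cubic field and $\mathbb Z[\rho]$ is an order in it. An element of $K$ is totally positive if all its images under the embeddings $K\to\mathbb R$ are positive. A totally positive $\alpha\in\mathbb Z[\rho]$ is indecomposable in $\mathbb Z[\rho]$ if it cannot be written as $\alpha=\beta+\gamma$ with $\beta,\gamma\in\mathbb Z[\rho]$ totally positive. $\mathrm{Tr}$ is the trace from $K$ to $\mathbb Q$. The codifferent is $\mathbb Z[\rho]^\vee=\{\delta\in K:\mathrm{Tr}(\alpha\delta)\in\mathbb Z\text{ for all }\alpha\in\mathbb Z[\rho]\}$, and $\mathbb Z[\rho]^{\vee,+}$ is the set of its totally positive elements. *)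

theory Defs
  imports Complex_Main "HOL-Computational_Algebra.Polynomial"
begin

definition is_subfield :: "'a::field_char_0 set \<Rightarrow> bool" where
  "is_subfield F \<longleftrightarrow> 0 \<in> F \<and> 1 \<in> F \<and>
     (\<forall>x\<in>F. \<forall>y\<in>F. x + y \<in> F \<and> x * y \<in> F) \<and> (\<forall>x\<in>F. - x \<in> F \<and> inverse x \<in> F)"

text \<open>The field \<open>\<rat>(\<rho>)\<close>; every subfield contains \<open>\<rat>\<close> because the characteristic is zero.\<close>

definition rat_adjoin :: "'a::field_char_0 \<Rightarrow> 'a set" where
  "rat_adjoin \<rho> = \<Inter>{F. is_subfield F \<and> \<rho> \<in> F}"

definition int_adjoin :: "'a::field_char_0 \<Rightarrow> 'a set" where
  "int_adjoin \<rho> = range (\<lambda>p :: int poly. poly (map_poly of_int p) \<rho>)"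

text \<open>Only the values on \<open>K\<close> of an embedding \<open>K \<rightarrow> \<real>\<close> matter; those outside \<open>K\<close> are arbitrary.\<close>

definition real_embedding :: "'a::field_char_0 set \<Rightarrow> ('a \<Rightarrow> real) \<Rightarrow> bool" where
  "real_embedding K \<sigma> \<longleftrightarrow> \<sigma> 1 = 1 \<and>
     (\<forall>x\<in>K. \<forall>y\<in>K. \<sigma> (x + y) = \<sigma> x + \<sigma> y \<and> \<sigma> (x * y) = \<sigma> x * \<sigma> y)"

definition totally_positive :: "'a::field_char_0 set \<Rightarrow> 'a \<Rightarrow> bool" where
  "totally_positive K x \<longleftrightarrow> x \<in> K \<and> (\<forall>\<sigma>. real_embedding K \<sigma> \<longrightarrow> 0 < \<sigma> x)"

global_interpretation rat_vs: vector_space "\<lambda>(q::rat) (x::'a::field_char_0). of_rat q * x"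
  by unfold_locales (simp_all add: algebra_simps of_rat_add of_rat_mult)

text \<open>
  The trace of the \<open>\<rat>\<close>-linear map \<open>y \<mapsto> x * y\<close> on \<open>K\<close>, i.e. the sum of the diagonal entries of
  its matrix with respect to a basis of \<open>K\<close> over \<open>\<rat>\<close>. For a finite extension the value does not
  depend on the basis chosen.
\<close>

definition field_trace :: "'a::field_char_0 set \<Rightarrow> 'a \<Rightarrow> rat" where
  "field_trace K x =
     (let B = (SOME B. rat_vs.independent B \<and> rat_vs.span B = K)
      in \<Sum>b\<in>B. rat_vs.representation B (x * b) b)"

definition codifferent :: "'a::field_char_0 set \<Rightarrow> 'a set \<Rightarrow> 'a set" where
  "codifferent K R = {\<delta> \<in> K. \<forall>\<alpha>\<in>R. field_trace K (\<alpha> * \<delta>) \<in> \<int>}"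

definition indecomposable :: "'a::field_char_0 set \<Rightarrow> 'a set \<Rightarrow> 'a \<Rightarrow> bool" where
  "indecomposable K R \<alpha> \<longleftrightarrow> \<alpha> \<in> R \<and> totally_positive K \<alpha> \<and>
     \<not> (\<exists>\<beta>\<in>R. \<exists>\<gamma>\<in>R. totally_positive K \<beta> \<and> totally_positive K \<gamma> \<and> \<alpha> = \<beta> + \<gamma>)"

definition is_unit_in :: "'a::field_char_0 set \<Rightarrow> 'a \<Rightarrow> bool" where
  "is_unit_in R \<alpha> \<longleftrightarrow> \<alpha> \<in> R \<and> (\<exists>\<beta>\<in>R. \<alpha> * \<beta> = 1)"

definition is_minimum :: "'b::order set \<Rightarrow> 'b \<Rightarrow> bool" where
  "is_minimum S m \<longleftrightarrow> m \<in> S \<and> (\<forall>s\<in>S. m \<le> s)"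

end

theory Submission
  imports Defs
begin

text \<open>
  Write \<open>f = X\<^sup>3 + (a - 1) X\<^sup>2 - a X - 1\<close>. The relation \<open>\<rho> (\<rho> - 1) (\<rho> + a) = 1\<close> provides the totally
  positive units \<open>\<rho>\<^sup>2\<close>, \<open>e\<^sub>2 = \<rho> (\<rho> - 1)\<close> and \<open>e\<^sub>3 = (\<rho> - 1) / \<rho>\<close>. The translates under totally positive
  units of the unimodular cone spanned by \<open>1, \<rho>\<^sup>2, e\<^sub>2\<close> and of the cone of index \<open>a\<close> spanned by
  \<open>1, e\<^sub>2, e\<^sub>3\<close> cover the totally positive elements. To see this, take the linear functionals equal
  to 1 on the generators of each of the two cones; both are positive on totally positive elements.
  Among all unit multiples of \<open>\<alpha>\<close> choose one where the smaller of the two values is minimal: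
  comparing with the three neighbouring cones gives exactly the inequalities that put this multiple
  into the corresponding cone.

  An indecomposable element of the first cone is one of its generators, hence a unit. In the second
  cone the only other candidates are \<open>\<beta> = 1 + k (1 - \<rho>)\<close> with \<open>1 \<le> k < a\<close>. From
  \<open>a \<beta> = (a - k) + k e\<^sub>2 + k e\<^sub>3\<close> one gets \<open>a Tr(\<beta> \<delta>) \<ge> a + k > a\<close> for every totally positive \<open>\<delta>\<close> in
  the codifferent, so that \<open>Tr(\<beta> \<delta>) \<ge> 2\<close>. The element \<open>\<delta> = (\<rho> + 1) / ((\<rho> - 1) f'(\<rho>))\<close> is totally
  positive with \<open>Tr(\<delta>) = Tr(\<rho> \<delta>) = 2\<close>, which gives equality.
\<close>

section \<open>The polynomial and combinations of powers of a root\<close>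

text \<open>The cubic f of Ennola's family, over any commutative ring because it is evaluated at
  rational, real and complex arguments.\<close>

definition ennola :: "int \<Rightarrow> 'a::comm_ring_1 \<Rightarrow> 'a" where
  "ennola a t = t ^ 3 + (of_int a - 1) * t\<^sup>2 - of_int a * t - 1"

text \<open>Coordinates with respect to 1, t, t^2. The point t is a parameter, so that the same
  coordinates can be evaluated at \<rho> and at each real root.\<close>

definition rcomb :: "'a::field_char_0 \<Rightarrow> rat \<Rightarrow> rat \<Rightarrow> rat \<Rightarrow> 'a" where
  "rcomb t x y z = of_rat x + of_rat y * t + of_rat z * t\<^sup>2"

definition icomb :: "'a::comm_ring_1 \<Rightarrow> int \<Rightarrow> int \<Rightarrow> int \<Rightarrow> 'a" where
  "icomb t x y z = of_int x + of_int y * t + of_int z * t\<^sup>2"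

lemma icomb_eq_rcomb: "icomb t x y z = rcomb t (of_int x) (of_int y) (of_int z)"
  by (simp add: icomb_def rcomb_def)

lemma rcomb_0: "rcomb t 0 0 0 = 0" and rcomb_1: "rcomb t 1 0 0 = 1"
  by (simp_all add: rcomb_def)

lemma rcomb_add: "rcomb t x y z + rcomb t x' y' z' = rcomb t (x + x') (y + y') (z + z')"
  by (simp add: rcomb_def of_rat_add algebra_simps)

lemma rcomb_uminus: "- rcomb t x y z = rcomb t (- x) (- y) (- z)"
  by (simp add: rcomb_def of_rat_minus algebra_simps)

text \<open>Rational root theorem: for s = m/n in lowest terms, f(s) = 0 becomes m (m - n) (m + a n)
  = n^3, so m and n are units, but neither 1 nor -1 is a root.\<close>

lemma ennola_no_rational_root:
  assumes "a \<ge> 3"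
  shows "ennola a (s :: rat) \<noteq> 0"
proof
  assume s: "ennola a s = 0"
  obtain m n where mn: "quotient_of s = (m, n)" by fastforce
  have n: "n > 0" and cop: "coprime m n"
    using mn by (auto simp: quotient_of_denom_pos quotient_of_coprime)
  have sq: "s = of_int m / of_int n" using mn by (rule quotient_of_div)
  have "of_int n ^ 3 * ennola a s =
      of_int (m * (m - n) * (m + a * n) - n ^ 3)"
    using n unfolding sq ennola_def by (simp add: field_simps power2_eq_square power3_eq_cube)
  then have "of_int (m * (m - n) * (m + a * n) - n ^ 3) = (0 :: rat)"
    using s by simp
  then have eq: "m * (m - n) * (m + a * n) = n ^ 3"
    by (simp only: of_int_eq_0_iff)
  have "m dvd n ^ 3" using eq[symmetric] by (simp add: mult.assoc)
  then have "is_unit m"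
    using cop by (metis coprime_common_divisor coprime_power_right_iff dvd_refl)
  have "n dvd m ^ 3"
  proof -
    have "m ^ 3 = n * (n\<^sup>2 - (a - 1) * m\<^sup>2 + a * m * n)"
      using eq by (simp add: algebra_simps power2_eq_square power3_eq_cube)
    then show ?thesis by simp
  qed
  then have "is_unit n"
    using cop by (metis coprime_common_divisor coprime_power_left_iff dvd_refl)
  with n have n1: "n = 1" by simp
  from \<open>is_unit m\<close> have "m = 1 \<or> m = -1" by auto
  then show False using eq n1 assms by auto
qed

lemma of_rat_ennola: "ennola a (of_rat s) = of_rat (ennola a s)"
  by (simp add: ennola_def of_rat_add of_rat_diff of_rat_mult of_rat_power)

text \<open>A linear relation would make t rational, and a quadratic one would leave f with a
  rational linear factor.\<close>

lemma rcomb_eq_0: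
  fixes t :: "'a::field_char_0"
  assumes a: "a \<ge> 3" and t: "ennola a t = 0" and eq: "rcomb t x y z = 0"
  shows "x = 0 \<and> y = 0 \<and> z = 0"
proof -
  have nrat: "t \<noteq> of_rat s" for s
    using t ennola_no_rational_root[OF a, of s] by (auto simp: of_rat_ennola)
  have lin: "u = 0 \<and> v = 0" if "of_rat u + of_rat v * t = 0" for u v
  proof (cases "v = 0")
    case False
    then have "t = of_rat (- u / v)"
      using that by (simp add: of_rat_divide of_rat_minus field_simps add_eq_0_iff)
    with nrat show ?thesis by blast
  qed (use that in simp)
  show ?thesis
  proof (cases "z = 0")
    case True
    then show ?thesis using lin eq by (simp add: rcomb_def)
  next
    case False
    define p q where "p = - y / z" and "q = - x / z"
    have sq: "t\<^sup>2 = of_rat p * t + of_rat q"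
    proof -
      have "of_rat z * t\<^sup>2 = - (of_rat y) * t - of_rat x"
        using eq unfolding rcomb_def by algebra
      moreover have "of_rat z * of_rat p = - (of_rat y :: 'a)" "of_rat z * of_rat q = - (of_rat x :: 'a)"
        using False by (simp_all add: p_def q_def of_rat_minus flip: of_rat_mult)
      ultimately have "of_rat z * t\<^sup>2 = of_rat z * (of_rat p * t + of_rat q)"
        by (simp add: distrib_left flip: mult.assoc)
      then show ?thesis using False by simp
    qed
    define A where "A = (of_int a :: rat)"
    have A: "of_int a = (of_rat A :: 'a)" by (simp add: A_def)
    have "0 = ennola a t" using t by simp
    also have "\<dots> = t * t\<^sup>2 + (of_rat A - 1) * t\<^sup>2 - of_rat A * t - 1"
      by (simp add: ennola_def A power3_eq_cube power2_eq_square)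
    also have "\<dots> = of_rat p * t\<^sup>2 + of_rat q * t + (of_rat A - 1) * t\<^sup>2 - of_rat A * t - 1"
      by (subst (1) sq) (simp add: algebra_simps power2_eq_square)
    also have "\<dots> = of_rat (p * q + (A - 1) * q - 1) + of_rat (p * p + q + (A - 1) * p - A) * t"
      unfolding sq by (simp add: of_rat_add of_rat_mult of_rat_diff algebra_simps)
    finally have "p * q + (A - 1) * q - 1 = 0" "p * p + q + (A - 1) * p - A = 0"
      using lin by metis+
    \<comment> \<open>The remainder of f modulo X^2 - p X - q vanishes. The roots of f sum to 1 - A
      and those of the quadratic to p, so the remaining root is 1 - A - p.\<close>
    then have "ennola a (1 - A - p) = 0"
      unfolding ennola_def A_def[symmetric] by algebra
    with ennola_no_rational_root[OF a] show ?thesis by blast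
  qed
qed

text \<open>The coefficients come from t^3 = 1 + A t - (A - 1) t^2 and the resulting reduction of
  t^4.\<close>

lemma rcomb_mult:
  fixes t :: "'a::field_char_0"
  assumes t: "ennola a t = 0"
  defines "A \<equiv> of_int a :: rat"
  shows "rcomb t x y z * rcomb t x' y' z' =
    rcomb t (x * x' + (y * z' + z * y') - (A - 1) * (z * z'))
       (x * y' + y * x' + A * (y * z' + z * y') + (1 - A * (A - 1)) * (z * z'))
       (x * z' + y * y' + z * x' - (A - 1) * (y * z' + z * y') + (A + (A - 1)\<^sup>2) * (z * z'))"
proof -
  have A: "of_int a = (of_rat A :: 'a)" by (simp add: A_def)
  show ?thesis
    using t unfolding ennola_def A rcomb_def of_rat_add of_rat_mult of_rat_diff of_rat_power of_rat_1
    by algebra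
qed

lemma icomb_mult:
  fixes t :: "'a::comm_ring_1"
  assumes t: "ennola a t = 0"
  shows "icomb t x y z * icomb t x' y' z' =
    icomb t (x * x' + (y * z' + z * y') - (a - 1) * (z * z'))
       (x * y' + y * x' + a * (y * z' + z * y') + (1 - a * (a - 1)) * (z * z'))
       (x * z' + y * y' + z * x' - (a - 1) * (y * z' + z * y') + (a + (a - 1)\<^sup>2) * (z * z'))"
proof -
  have 3: "t ^ 3 = 1 + of_int a * t - (of_int a - 1) * t\<^sup>2"
    using t by (simp add: ennola_def algebra_simps)
  have 4: "t ^ 4 = t * t ^ 3" by (simp add: power_numeral_reduce)
  have "icomb t x y z * icomb t x' y' z' =
     of_int (x * x') + of_int (x * y' + y * x') * t + of_int (x * z' + y * y' + z * x') * t\<^sup>2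
     + of_int (y * z' + z * y') * t ^ 3 + of_int (z * z') * t ^ 4"
    by (simp add: icomb_def algebra_simps power_numeral_reduce)
  also have "t ^ 4 = t + of_int a * t\<^sup>2 - (of_int a - 1) * t ^ 3"
    unfolding 4 by (subst 3) (simp add: algebra_simps power_numeral_reduce)
  also have "of_int (x * x') + of_int (x * y' + y * x') * t + of_int (x * z' + y * y' + z * x') * t\<^sup>2
     + of_int (y * z' + z * y') * t ^ 3 + of_int (z * z') * (t + of_int a * t\<^sup>2 - (of_int a - 1) * t ^ 3)
     = icomb t (x * x' + (y * z' + z * y') - (a - 1) * (z * z'))
       (x * y' + y * x' + a * (y * z' + z * y') + (1 - a * (a - 1)) * (z * z'))
       (x * z' + y * y' + z * x' - (a - 1) * (y * z' + z * y') + (a + (a - 1)\<^sup>2) * (z * z'))"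
    unfolding 3 icomb_def by (simp add: algebra_simps power2_eq_square)
  finally show ?thesis .
qed

text \<open>Sign changes of f on [1, 2], [-1/a, 0] and [-a, 1 - a]; f is nonzero at the end points,
  hence the strict bounds. Later sign arguments at the roots rest on these bounds.\<close>

lemma ennola_real_roots:
  assumes a: "a \<ge> 3"
  obtains r1 r2 r3 :: real where
    "ennola a r1 = 0" "ennola a r2 = 0" "ennola a r3 = 0"
    "1 < r1" "- 1 / of_int a < r2" "r2 < 0" "- of_int a < r3" "r3 < 1 - of_int a"
proof -
  define A where "A = real_of_int a"
  have A: "A \<ge> 3" using a by (simp add: A_def)
  have f: "ennola a = (\<lambda>t::real. t ^ 3 + (A - 1) * t\<^sup>2 - A * t - 1)"
    by (simp add: ennola_def A_def fun_eq_iff)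
  have cont: "continuous_on S (ennola a :: real \<Rightarrow> real)" for S
    unfolding f by (intro continuous_intros)
  have v1: "ennola a (1::real) = -1" "ennola a (2::real) > 0" "ennola a (0::real) = -1"
    using A by (simp_all add: f)
  have v2: "ennola a (- 1 / A) > 0"
  proof -
    have "ennola a (- 1 / A) = (A\<^sup>2 - A - 1) / A ^ 3"
      using A by (simp add: f field_simps power2_eq_square power3_eq_cube)
    moreover have "A\<^sup>2 - A - 1 > 0"
      using mult_mono[of 3 A 1 "A - 1"] A by (simp add: power2_eq_square algebra_simps)
    ultimately show ?thesis using A by simp
  qed
  have v3: "ennola a (- A) = -1" by (simp add: f algebra_simps power2_eq_square power3_eq_cube)
  have v4: "ennola a (1 - A) > 0"
  proof -
    have "ennola a (1 - A) = A * (A - 1) - 1"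
      by (simp add: f algebra_simps power2_eq_square power3_eq_cube)
    moreover have "A * (A - 1) > 1"
      using mult_mono[of 3 A 1 "A - 1"] A by simp
    ultimately show ?thesis by simp
  qed
  have "\<exists>x\<ge>1. x \<le> 2 \<and> ennola a x = (0::real)"
    by (rule IVT') (use v1 cont in auto)
  then obtain r1 :: real where r1: "1 \<le> r1" "ennola a r1 = 0"
    by blast
  obtain r2 where r2: "- 1 / A \<le> r2" "r2 \<le> 0" "ennola a r2 = 0"
    using IVT2'[of "ennola a" "0::real" 0 "- 1 / A"] v1 v2 cont A by auto
  obtain r3 where r3: "- A \<le> r3" "r3 \<le> 1 - A" "ennola a r3 = 0"
    using IVT'[of "ennola a" "- A" 0 "1 - A"] v3 v4 cont by auto
  show ?thesis
    by (rule that[of r1 r2 r3]) (use r1 r2 r3 v1 v2 v3 v4 in \<open>auto simp: less_le A_def\<close>)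
qed

text \<open>Both sides equal the double sum over \<open>b\<close> and \<open>c\<close> of the \<open>c\<close>-coordinate of \<open>f b\<close> times the
  \<open>b\<close>-coordinate of \<open>c\<close>.\<close>

lemma (in vector_space) trace_basis_independent:
  assumes B: "independent B" "finite B" and C: "independent C" "finite C"
    and eq: "span B = span C"
    and lin: "Vector_Spaces.linear scale scale f" and f: "f ` span B \<subseteq> span B"
  shows "(\<Sum>b\<in>B. representation B (f b) b) = (\<Sum>c\<in>C. representation C (f c) c)"
proof -
  interpret f: Vector_Spaces.linear scale scale f by fact
  have fB: "f v \<in> span B" "f v \<in> span C" if "v \<in> span B" for v
    using f that eq by auto
  have CB: "c \<in> span B" if "c \<in> C" for c using that eq span_base by auto
  have 1: "representation B (f b) b =
      (\<Sum>c\<in>C. representation C (f b) c * representation B c b)" if "b \<in> B" for b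
  proof -
    have "f b = (\<Sum>c\<in>C. representation C (f b) c *s c)"
      using sum_representation_eq[OF C(1) fB(2)[OF span_base[OF that]] C(2)] by simp
    then have "representation B (f b) b
        = representation B (\<Sum>c\<in>C. representation C (f b) c *s c) b" by simp
    also have "\<dots> = (\<Sum>c\<in>C. representation C (f b) c * representation B c b)"
      using CB by (simp add: representation_sum[OF B(1)] representation_scale[OF B(1)] span_scale)
    finally show ?thesis .
  qed
  have 2: "(\<Sum>b\<in>B. representation C (f b) c * representation B c b) = representation C (f c) c"
    if "c \<in> C" for c
  proof -
    have "c = (\<Sum>b\<in>B. representation B c b *s b)"
      using sum_representation_eq[OF B(1) CB[OF that] B(2)] by simp
    then have "f c = f (\<Sum>b\<in>B. representation B c b *s b)" by simp
    also have "\<dots> = (\<Sum>b\<in>B. representation B c b *s f b)"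
      by (simp add: f.sum f.scale)
    finally have "representation C (f c) c
        = representation C (\<Sum>b\<in>B. representation B c b *s f b) c" by simp
    also have "\<dots> = (\<Sum>b\<in>B. representation B c b * representation C (f b) c)"
      using fB(2)[OF span_base]
      by (simp add: representation_sum[OF C(1)] representation_scale[OF C(1)] span_scale)
    finally show ?thesis by (simp add: mult.commute)
  qed
  show ?thesis
    by (simp add: 1 2 sum.swap[of _ C B] cong: sum.cong)
qed


lemma rational_in_subfield:
  fixes F :: "'b::field_char_0 set"
  assumes "is_subfield F"
  shows "of_rat q \<in> F"
proof -
  have nat: "of_nat n \<in> F" for n
    using assms by (induction n) (auto simp: is_subfield_def)
  have int: "of_int m \<in> F" for m
  proof (cases m rule: int_diff_cases)
    case (diff i j)
    then have "of_int m = of_nat i + - (of_nat j :: 'b)" by simp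
    then show ?thesis using nat[of i] nat[of j] assms unfolding is_subfield_def by metis
  qed
  obtain m n where "q = of_int m / of_int n" by (metis quotient_of_div surj_pair)
  then have "of_rat q = of_int m * inverse (of_int n :: 'b)"
    by (simp add: of_rat_divide flip: divide_inverse)
  then show ?thesis using int[of m] int[of n] assms unfolding is_subfield_def by metis
qed

lemma combination_positive:
  fixes n1 n2 n3 :: int and e1 e2 e3 :: real
  assumes "0 \<le> n1" "0 \<le> n2" "0 \<le> n3" "0 < n1 \<or> 0 < n2 \<or> 0 < n3" "0 < e1" "0 < e2" "0 < e3"
  shows "0 < of_int n1 * e1 + of_int n2 * e2 + of_int n3 * e3"
proof -
  have "0 \<le> of_int n1 * e1" "0 \<le> of_int n2 * e2" "0 \<le> of_int n3 * e3" using assms by simp_all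
  moreover have "0 < of_int n1 * e1 \<or> 0 < of_int n2 * e2 \<or> 0 < of_int n3 * e3"
    using assms(4-7) by auto
  ultimately show ?thesis by linarith
qed

section \<open>The field and its order\<close>

text \<open>Here \<rho> is an arbitrary complex root, while \<open>r1\<close>, \<open>r2\<close>,
  \<open>r3\<close> parametrise the real embeddings of its field.\<close>

locale ennola_cubic =
  fixes a :: int and \<rho> :: complex and r1 r2 r3 :: real
  assumes a3: "a \<ge> 3" and root: "ennola a \<rho> = 0"
    and real_roots: "ennola a r1 = 0" "ennola a r2 = 0" "ennola a r3 = 0"
    and bounds: "1 < r1" "- 1 / of_int a < r2" "r2 < 0" "- of_int a < r3" "r3 < 1 - of_int a"
begin

lemma distinct_roots: "r1 > r2" "r2 > r3"
proof -
  have "- 1 / real_of_int a \<ge> - 1 / 3" using a3 by simp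
  then show "r1 > r2" "r2 > r3" using bounds a3 by linarith+
qed

text \<open>Divided differences: subtracting the equations for two roots and dividing by the nonzero
  difference of the roots, twice, isolates their sum; the other two relations follow by
  substitution.\<close>

lemma vieta:
  "r1 + r2 + r3 = 1 - of_int a" "r1 * r2 + r1 * r3 + r2 * r3 = - of_int a" "r1 * r2 * r3 = 1"
proof -
  define A where "A = real_of_int a"
  note eqs = real_roots[unfolded ennola_def, folded A_def]
  have 1: "r1\<^sup>2 + r1 * r2 + r2\<^sup>2 + (A - 1) * (r1 + r2) - A = 0"
  proof -
    have "(r1 - r2) * (r1\<^sup>2 + r1 * r2 + r2\<^sup>2 + (A - 1) * (r1 + r2) - A) = 0"
      using eqs(1,2) by algebra
    then show ?thesis using distinct_roots by simp
  qed
  have 2: "r2\<^sup>2 + r2 * r3 + r3\<^sup>2 + (A - 1) * (r2 + r3) - A = 0"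
  proof -
    have "(r2 - r3) * (r2\<^sup>2 + r2 * r3 + r3\<^sup>2 + (A - 1) * (r2 + r3) - A) = 0"
      using eqs(2,3) by algebra
    then show ?thesis using distinct_roots by simp
  qed
  have 3: "r1 + r2 + r3 = 1 - A"
  proof -
    have "(r1 - r3) * (r1 + r2 + r3 - (1 - A)) = 0" using 1 2 by algebra
    then show ?thesis using distinct_roots by simp
  qed
  then have 4: "r1 * r2 + r1 * r3 + r2 * r3 = - A" using 1 by algebra
  have 5: "r1 * r2 * r3 = 1" using 3 4 eqs(1) by algebra
  show "r1 + r2 + r3 = 1 - of_int a" "r1 * r2 + r1 * r3 + r2 * r3 = - of_int a" "r1 * r2 * r3 = 1"
    using 3 4 5 by (simp_all add: A_def)
qed

lemma real_root_iff: "ennola a t = 0 \<longleftrightarrow> t = r1 \<or> t = r2 \<or> t = r3" for t :: real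
proof -
  have "ennola a t = (t - r1) * (t - r2) * (t - r3)"
    using vieta unfolding ennola_def by algebra
  then show ?thesis by simp
qed

abbreviation "K \<equiv> rat_adjoin \<rho>"
abbreviation "R \<equiv> int_adjoin \<rho>"

lemma rcomb_inject: "rcomb t x y z = rcomb t x' y' z' \<longleftrightarrow> x = x' \<and> y = y' \<and> z = z'"
  if "ennola a t = 0" for t :: "'a::field_char_0"
proof
  assume "rcomb t x y z = rcomb t x' y' z'"
  then have "rcomb t x y z + - rcomb t x' y' z' = 0" by simp
  then have "rcomb t (x - x') (y - y') (z - z') = 0" by (simp add: rcomb_uminus rcomb_add)
  from rcomb_eq_0[OF a3 that this] show "x = x' \<and> y = y' \<and> z = z'" by simp
qed simp

text \<open>The inverse of \<open>x + y \<rho> + z \<rho>\<^sup>2\<close> is the product of its two other conjugates, written in terms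
  of the sum \<open>S\<close> and the product \<open>P\<close> of the other roots, divided by the norm.\<close>

lemma rcomb_inverse: "\<exists>x' y' z'. inverse (rcomb \<rho> x y z) = rcomb \<rho> x' y' z'"
proof (cases "rcomb \<rho> x y z = 0")
  case True
  then show ?thesis using rcomb_0 by (metis inverse_zero)
next
  case False
  define A where "A = rat_of_int a"
  define N where "N = x ^ 3 + x\<^sup>2 * y * (1 - A) + x\<^sup>2 * z * ((1 - A)\<^sup>2 + 2 * A) - x * y\<^sup>2 * A
     - x * y * z * (A * (1 - A) + 3) + x * z\<^sup>2 * (A\<^sup>2 - 2 * (1 - A)) + y ^ 3 + y\<^sup>2 * z * (1 - A)
     - y * z\<^sup>2 * A + z ^ 3"
  \<comment> \<open>That the norm is nonzero is checked over the reals, where it is a product of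
    three values at roots of f, none of which vanishes by \<open>rcomb_eq_0\<close>.\<close>
  have "of_rat N = rcomb r1 x y z * rcomb r2 x y z * rcomb r3 x y z"
    using vieta unfolding N_def A_def rcomb_def of_rat_add of_rat_diff of_rat_mult of_rat_power
      of_rat_of_int_eq of_rat_1 of_rat_numeral_eq
    by algebra
  moreover have "rcomb r x y z \<noteq> 0" if "ennola a r = 0" for r :: real
    using rcomb_eq_0[OF a3 that] False rcomb_0 by blast
  ultimately have "of_rat N \<noteq> (0 :: real)" using real_roots by simp
  then have N: "N \<noteq> 0" by auto
  let ?S = "\<lambda>s. \<exists>x y z. s = rcomb \<rho> x y z"
  have plus: "?S (s + s')" if "?S s" "?S s'" for s s' using that rcomb_add by metis
  have times: "?S (s * s')" if "?S s" "?S s'" for s s' using that rcomb_mult[OF root] by metis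
  have rat: "?S (of_rat q)" for q
    by (rule exI[of _ q], rule exI[of _ 0], rule exI[of _ 0]) (simp add: rcomb_def)
  \<comment> \<open>The roots sum to 1 - A and have product 1, so S = 1 - A - \<rho> and P =
    1/\<rho> = \<rho>^2 + (A - 1) \<rho> - A.\<close>
  define S P where "S = rcomb \<rho> (1 - A) (- 1) 0" and "P = rcomb \<rho> (- A) (A - 1) 1"
  have SP: "?S S" "?S P" unfolding S_def P_def by blast+
  define adj where "adj = of_rat (x\<^sup>2) + of_rat (x * y) * S + of_rat (x * z) * (S * S + of_rat (-2) * P)
    + of_rat (y\<^sup>2) * P + of_rat (y * z) * (P * S) + of_rat (z\<^sup>2) * (P * P)"
  have "?S (of_rat (1 / N) * adj)"
    unfolding adj_def by (intro plus times rat SP)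
  moreover have "rcomb \<rho> x y z * adj = of_rat N"
  proof -
    have A: "of_int a = (of_rat A :: complex)" by (simp add: A_def)
    have 1: "S = 1 - of_rat A - \<rho>"
      by (simp add: S_def rcomb_def of_rat_diff of_rat_minus)
    have 2: "P = \<rho>\<^sup>2 + (of_rat A - 1) * \<rho> - of_rat A"
      by (simp add: P_def rcomb_def of_rat_diff of_rat_minus)
    have 3: "\<rho> * P = 1" using root unfolding 2 ennola_def A by algebra
    have 4: "P + \<rho> * S = - of_rat A" unfolding 1 2 by algebra
    have 5: "\<rho> + S = 1 - of_rat A" using 1 by simp
    have m2: "of_rat (-2) = (-2 :: complex)" by (simp add: of_rat_minus)
    show ?thesis
      using 3 4 5 unfolding adj_def N_def rcomb_def of_rat_add of_rat_diff of_rat_mult of_rat_power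
        of_rat_1 of_rat_numeral_eq m2
      by algebra
  qed
  then have "rcomb \<rho> x y z * (of_rat (1 / N) * adj) = 1"
    using N by (simp add: of_rat_divide)
  then have "inverse (rcomb \<rho> x y z) = of_rat (1 / N) * adj"
    by (rule inverse_unique)
  ultimately show ?thesis by simp
qed

lemma K_subfield: "is_subfield K"
  unfolding rat_adjoin_def is_subfield_def by blast

lemma rho_in_K: "\<rho> \<in> K" by (auto simp: rat_adjoin_def)

lemma K_closed [intro]:
  "x \<in> K \<Longrightarrow> y \<in> K \<Longrightarrow> x + y \<in> K" "x \<in> K \<Longrightarrow> y \<in> K \<Longrightarrow> x * y \<in> K"
  "x \<in> K \<Longrightarrow> - x \<in> K" "x \<in> K \<Longrightarrow> inverse x \<in> K" "of_rat q \<in> K"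
  using K_subfield rational_in_subfield[OF K_subfield] unfolding is_subfield_def by auto

lemma K_eq: "K = {s. \<exists>x y z. s = rcomb \<rho> x y z}"
proof
  have "is_subfield {s. \<exists>x y z. s = rcomb \<rho> x y z}"
    unfolding is_subfield_def mem_Collect_eq
  proof (intro conjI ballI; (elim CollectE exE)?)
    show "\<exists>x y z. 0 = rcomb \<rho> x y z" "\<exists>x y z. 1 = rcomb \<rho> x y z"
      using rcomb_0 rcomb_1 by metis+
  qed (metis rcomb_add, metis rcomb_mult[OF root], metis rcomb_uminus, metis rcomb_inverse)
  moreover have "\<rho> = rcomb \<rho> 0 1 0" by (simp add: rcomb_def)
  ultimately show "K \<subseteq> {s. \<exists>x y z. s = rcomb \<rho> x y z}"
    unfolding rat_adjoin_def by blast
  show "{s. \<exists>x y z. s = rcomb \<rho> x y z} \<subseteq> K"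
    using rho_in_K by (auto simp: rcomb_def power2_eq_square)
qed

lemma rcomb_in_K: "rcomb \<rho> x y z \<in> K" unfolding K_eq by blast

lemma R_eq: "R = {s. \<exists>x y z. s = icomb \<rho> x y z}"
proof
  have "\<exists>x y z. poly (map_poly of_int p) \<rho> = icomb \<rho> x y z" for p :: "int poly"
  proof (induction p)
    case 0
    have "0 = icomb \<rho> 0 0 0" by (simp add: icomb_def)
    then show ?case by (metis map_poly_0 poly_0)
  next
    case (pCons c p)
    then obtain x y z where xyz: "poly (map_poly of_int p) \<rho> = icomb \<rho> x y z" by blast
    have "map_poly of_int (pCons c p) = pCons (of_int c :: complex) (map_poly of_int p)"
      by (rule map_poly_pCons) simp
    then have "poly (map_poly of_int (pCons c p)) \<rho> = icomb \<rho> c 0 0 + icomb \<rho> 0 1 0 * icomb \<rho> x y z"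
      by (simp add: xyz icomb_def)
    also have "\<dots> = icomb \<rho> (c + z) (x + a * z) (y - (a - 1) * z)"
      unfolding icomb_mult[OF root] by (simp add: icomb_def algebra_simps)
    finally show ?case by blast
  qed
  then show "R \<subseteq> {s. \<exists>x y z. s = icomb \<rho> x y z}" by (auto simp: int_adjoin_def)
next
  have "icomb \<rho> x y z = poly (map_poly of_int [:x, y, z:]) \<rho>" for x y z
    by (simp add: icomb_def map_poly_pCons algebra_simps power2_eq_square)
  then show "{s. \<exists>x y z. s = icomb \<rho> x y z} \<subseteq> R" by (auto simp: int_adjoin_def)
qed

lemma icomb_in_R: "icomb \<rho> x y z \<in> R" unfolding R_eq by blast

lemma R_subset_K: "R \<subseteq> K" unfolding R_eq K_eq by (auto simp: icomb_eq_rcomb)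

lemma R_mult: "s \<in> R \<Longrightarrow> s' \<in> R \<Longrightarrow> s * s' \<in> R"
  unfolding R_eq mem_Collect_eq by (metis icomb_mult[OF root])


subsection \<open>Embeddings and trace\<close>

text \<open>The value of the embedding \<open>\<rho> \<mapsto> t\<close> on \<open>K\<close>; unspecified outside \<open>K\<close>.\<close>

definition emb :: "real \<Rightarrow> complex \<Rightarrow> real" where
  "emb t s = (THE v. \<exists>x y z. s = rcomb \<rho> x y z \<and> v = rcomb t x y z)"

lemma emb_rcomb: "emb t (rcomb \<rho> x y z) = rcomb t x y z"
  unfolding emb_def by (rule the_equality) (auto simp: rcomb_inject[OF root])

lemma emb_icomb: "emb t (icomb \<rho> x y z) = icomb t x y z"
  by (simp add: icomb_eq_rcomb emb_rcomb)

lemma emb_1: "emb t 1 = 1"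
  using emb_rcomb[of t 1 0 0] by (simp add: rcomb_1)

lemma emb_add: "s \<in> K \<Longrightarrow> s' \<in> K \<Longrightarrow> emb t (s + s') = emb t s + emb t s'"
  by (auto simp: K_eq rcomb_add emb_rcomb)

lemma emb_mult: "ennola a t = 0 \<Longrightarrow> s \<in> K \<Longrightarrow> s' \<in> K \<Longrightarrow> emb t (s * s') = emb t s * emb t s'"
  by (auto simp: K_eq rcomb_mult[OF root] emb_rcomb rcomb_mult[of a t])

lemma real_embedding_emb: "ennola a t = 0 \<Longrightarrow> real_embedding K (emb t)"
  by (simp add: real_embedding_def emb_1 emb_add emb_mult)

text \<open>An embedding fixes the rationals, so it is determined by the image of \<rho>, which is
  again a root of f.\<close>

lemma real_embedding_eq_emb:
  assumes \<sigma>: "real_embedding K \<sigma>"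
  obtains t where "ennola a t = 0" "\<And>s. s \<in> K \<Longrightarrow> \<sigma> s = emb t s"
proof -
  have add: "\<sigma> (s + s') = \<sigma> s + \<sigma> s'" and mult: "\<sigma> (s * s') = \<sigma> s * \<sigma> s'"
    if "s \<in> K" "s' \<in> K" for s s'
    using \<sigma> that by (auto simp: real_embedding_def)
  have one: "\<sigma> 1 = 1" using \<sigma> by (simp add: real_embedding_def)
  have ratK: "of_rat q \<in> K" for q by blast
  have zero: "\<sigma> 0 = 0" using add[of 0 0] ratK[of 0] by simp
  have nat: "\<sigma> (of_rat (of_nat n)) = of_nat n" for n
  proof (induction n)
    case (Suc n)
    have "\<sigma> (of_rat (of_nat (Suc n))) = \<sigma> (of_rat 1 + of_rat (of_nat n))"
      by (simp only: of_nat_Suc of_rat_add)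
    also have "\<dots> = of_nat (Suc n)"
      using one Suc by (subst add[OF ratK ratK]) simp
    finally show ?case .
  qed (simp add: zero)
  have int: "\<sigma> (of_rat (of_int m)) = of_int m" for m
  proof (cases m rule: int_diff_cases)
    case (diff i j)
    have "of_rat (of_int m) + of_rat (of_nat j) = (of_rat (of_nat i) :: complex)"
      by (simp add: diff of_rat_diff)
    then have "\<sigma> (of_rat (of_int m) + of_rat (of_nat j)) = of_int m + of_nat j"
      using nat[of i] by (simp only: diff)
    then show ?thesis by (subst (asm) add[OF ratK ratK]) (simp only: nat)
  qed
  have rat: "\<sigma> (of_rat q) = of_rat q" for q
  proof -
    obtain m n where mn: "quotient_of q = (m, n)" by fastforce
    then have n: "n > 0" and q: "q = of_int m / of_int n"
      by (auto simp: quotient_of_denom_pos quotient_of_div)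
    have "\<sigma> (of_rat q * of_rat (of_int n)) = of_int m"
      using n int[of m] unfolding q of_rat_mult[symmetric] by simp
    then have "\<sigma> (of_rat q) * of_int n = of_int m"
      by (subst (asm) mult[OF ratK ratK]) (simp only: int)
    then show ?thesis using n by (simp add: q of_rat_divide field_simps)
  qed
  have comb: "\<sigma> (rcomb \<rho> x y z) = rcomb (\<sigma> \<rho>) x y z" for x y z
  proof -
    have K: "of_rat x + of_rat y * \<rho> \<in> K" "of_rat y * \<rho> \<in> K" "\<rho> * \<rho> \<in> K" "of_rat z * (\<rho> * \<rho>) \<in> K"
      using rho_in_K ratK by (blast intro: K_closed)+
    show ?thesis
      unfolding rcomb_def power2_eq_square
      by (simp add: add[OF K(1,4)] add[OF ratK K(2)] mult[OF ratK K(3)] mult[OF ratK rho_in_K]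
          mult[OF rho_in_K rho_in_K] rat)
  qed
  show ?thesis
  proof (rule that)
    \<comment> \<open>The equation f(\<rho>) = 0 in the form (\<rho>^2 + (a - 1) \<rho> - a) \<rho>
      = 1, a product to which multiplicativity applies directly.\<close>
    have "rcomb \<rho> (- of_int a) (of_int a - 1) 1 * rcomb \<rho> 0 1 0 = rcomb \<rho> 1 0 0"
      using root unfolding ennola_def rcomb_def of_rat_diff of_rat_minus of_rat_of_int_eq
      by simp algebra
    then have "\<sigma> (rcomb \<rho> (- of_int a) (of_int a - 1) 1 * rcomb \<rho> 0 1 0) = \<sigma> (rcomb \<rho> 1 0 0)"
      by simp
    then have "rcomb (\<sigma> \<rho>) (- of_int a) (of_int a - 1) 1 * rcomb (\<sigma> \<rho>) 0 1 0 = rcomb (\<sigma> \<rho>) 1 0 0"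
      by (simp only: mult[OF rcomb_in_K rcomb_in_K] comb)
    then show "ennola a (\<sigma> \<rho>) = 0"
      unfolding ennola_def rcomb_def of_rat_diff of_rat_minus of_rat_of_int_eq
      by simp algebra
    show "\<sigma> s = emb (\<sigma> \<rho>) s" if "s \<in> K" for s
      using that by (auto simp: K_eq comb emb_rcomb)
  qed
qed

lemma totally_positive_iff:
  "totally_positive K s \<longleftrightarrow> s \<in> K \<and> 0 < emb r1 s \<and> 0 < emb r2 s \<and> 0 < emb r3 s"
proof -
  have "(\<forall>\<sigma>. real_embedding K \<sigma> \<longrightarrow> 0 < \<sigma> s) \<longleftrightarrow> (\<forall>t. ennola a t = 0 \<longrightarrow> 0 < emb t s)" if "s \<in> K"
    using that real_embedding_emb real_embedding_eq_emb by metis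
  then show ?thesis by (auto simp: totally_positive_def real_root_iff)
qed

lemma totally_positive_mult:
  "totally_positive K s \<Longrightarrow> totally_positive K s' \<Longrightarrow> totally_positive K (s * s')"
  by (auto simp: totally_positive_iff emb_mult real_roots)

lemma totally_positive_inverse:
  assumes "totally_positive K s" "s' \<in> K" "s * s' = 1"
  shows "totally_positive K s'"
proof -
  have "emb t s * emb t s' = 1" if "ennola a t = 0" for t
    using assms emb_mult[OF that, of s s'] by (simp add: emb_1 totally_positive_iff)
  then show ?thesis
    using assms(1,2) real_roots unfolding totally_positive_iff
    by (metis zero_less_mult_pos zero_less_one)
qed

section \<open>The power basis and the trace\<close>

lemma power_basis:
  defines "B \<equiv> {1, \<rho>, \<rho>\<^sup>2}"
  shows "rat_vs.independent B" "rat_vs.span B = K" "finite B"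
    and "1 \<noteq> \<rho>" "\<rho> \<noteq> \<rho>\<^sup>2" "1 \<noteq> \<rho>\<^sup>2"
    and "rat_vs.representation B (rcomb \<rho> x y z) 1 = x"
    and "rat_vs.representation B (rcomb \<rho> x y z) \<rho> = y"
    and "rat_vs.representation B (rcomb \<rho> x y z) (\<rho>\<^sup>2) = z"
proof -
  have pw: "1 = rcomb \<rho> 1 0 0" "\<rho> = rcomb \<rho> 0 1 0" "\<rho>\<^sup>2 = rcomb \<rho> 0 0 1"
    by (simp_all add: rcomb_def)
  show ne: "1 \<noteq> \<rho>" "\<rho> \<noteq> \<rho>\<^sup>2" "1 \<noteq> \<rho>\<^sup>2"
    using pw rcomb_inject[OF root] by (metis zero_neq_one)+
  show fin: "finite B" by (simp add: B_def)
  have sum: "(\<Sum>b\<in>B. of_rat (f b) * b) = rcomb \<rho> (f 1) (f \<rho>) (f (\<rho>\<^sup>2))" for f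
    unfolding B_def using ne by (simp add: rcomb_def add.assoc)
  show ind: "rat_vs.independent B"
  proof (rule rat_vs.independent_if_scalars_zero[OF fin])
    fix f b assume "(\<Sum>x\<in>B. of_rat (f x) * x) = 0" "b \<in> B"
    then show "f b = 0" using rcomb_eq_0[OF a3 root] unfolding sum unfolding B_def by blast
  qed
  show span: "rat_vs.span B = K"
  proof
    show "rat_vs.span B \<subseteq> K"
      unfolding rat_vs.span_finite[OF fin] using sum rcomb_in_K by auto
    have "rcomb \<rho> x y z \<in> rat_vs.span B" for x y z
      unfolding rat_vs.span_finite[OF fin] using ne
      by (intro image_eqI[of _ _ "\<lambda>b. if b = 1 then x else if b = \<rho> then y else z"])
        (auto simp: sum)
    then show "K \<subseteq> rat_vs.span B" unfolding K_eq by blast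
  qed
  have rep: "rcomb \<rho> x y z = rcomb \<rho> (f 1) (f \<rho>) (f (\<rho>\<^sup>2))"
    if "f = rat_vs.representation B (rcomb \<rho> x y z)" for f
    using rat_vs.sum_representation_eq[OF ind _ fin order_refl, of "rcomb \<rho> x y z"] rcomb_in_K
    unfolding that sum span by simp
  show "rat_vs.representation B (rcomb \<rho> x y z) 1 = x"
    "rat_vs.representation B (rcomb \<rho> x y z) \<rho> = y"
    "rat_vs.representation B (rcomb \<rho> x y z) (\<rho>\<^sup>2) = z"
    using rep[OF refl] rcomb_inject[OF root] by metis+
qed

text \<open>The arbitrarily chosen basis is exchanged for the power basis. The constants 3, 1 - a
  and a^2 + 1 are the power sums of the roots in degrees 0, 1 and 2.\<close>

lemma field_trace_rcomb:
  "field_trace K (rcomb \<rho> x y z) = 3 * x + (1 - of_int a) * y + (of_int a ^ 2 + 1) * z"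
proof -
  define s where "s = rcomb \<rho> x y z"
  define B where "B = {1, \<rho>, \<rho>\<^sup>2}"
  note basis = power_basis[folded B_def]
  define C where "C = (SOME B. rat_vs.independent B \<and> rat_vs.span B = K)"
  have C: "rat_vs.independent C" "rat_vs.span C = K"
    using someI[of "\<lambda>B. rat_vs.independent B \<and> rat_vs.span B = K" B] basis(1,2)
    by (auto simp: C_def)
  have finC: "finite C"
    using rat_vs.independent_span_bound[OF basis(3) C(1)] rat_vs.span_superset[of C] C basis(2)
    by simp
  have lin: "Vector_Spaces.linear (\<lambda>q x. of_rat q * x) (\<lambda>q x. of_rat q * x) ((*) s)"
    by unfold_locales (simp_all add: algebra_simps)
  have "field_trace K s = (\<Sum>b\<in>C. rat_vs.representation C (s * b) b)"
    by (simp add: field_trace_def C_def Let_def)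
  also have "\<dots> = (\<Sum>b\<in>B. rat_vs.representation B (s * b) b)"
    by (rule rat_vs.trace_basis_independent[OF C(1) finC basis(1,3) _ lin])
      (use C basis(2) rcomb_in_K in \<open>auto simp: s_def\<close>)
  also have "\<dots> = rat_vs.representation B (s * 1) 1 + rat_vs.representation B (s * \<rho>) \<rho>
      + rat_vs.representation B (s * \<rho>\<^sup>2) (\<rho>\<^sup>2)"
    unfolding B_def using basis(4-6) by (simp add: add.assoc)
  also have "s * \<rho> = rcomb \<rho> x y z * rcomb \<rho> 0 1 0" by (simp add: s_def rcomb_def)
  also have "s * \<rho>\<^sup>2 = rcomb \<rho> x y z * rcomb \<rho> 0 0 1" by (simp add: s_def rcomb_def)
  also have "s * 1 = rcomb \<rho> x y z" by (simp add: s_def)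
  finally show ?thesis
    unfolding rcomb_mult[OF root] basis(7-9) s_def by (simp add: algebra_simps power2_eq_square)
qed

lemma field_trace_eq: "s \<in> K \<Longrightarrow> of_rat (field_trace K s) = emb r1 s + emb r2 s + emb r3 s"
proof -
  assume "s \<in> K"
  then obtain x y z where s: "s = rcomb \<rho> x y z" unfolding K_eq by blast
  have "r1\<^sup>2 + r2\<^sup>2 + r3\<^sup>2 = of_int a ^ 2 + 1" using vieta by algebra
  then show ?thesis
    unfolding s field_trace_rcomb emb_rcomb
    using vieta(1) unfolding rcomb_def of_rat_add of_rat_mult of_rat_diff of_rat_power
      of_rat_of_int_eq of_rat_1 of_rat_numeral_eq by algebra
qed


subsection \<open>Reduction to two cones\<close>

text \<open>The dual basis of \<open>1, t, t\<^sup>2\<close> with respect to the trace consists of the coefficients of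
  \<open>f(X) / (X - t)\<close>, divided by \<open>f'(t)\<close>.\<close>

lemma dual_basis:
  fixes p q r x y z :: real
  defines "d t \<equiv> p * (t\<^sup>2 + (of_int a - 1) * t - of_int a) + q * (t + of_int a - 1) + r"
    and "h t \<equiv> x + y * t + z * t\<^sup>2"
  shows "d r1 / ((r1 - r2) * (r1 - r3)) * h r1 + d r2 / ((r2 - r1) * (r2 - r3)) * h r2
       + d r3 / ((r3 - r1) * (r3 - r2)) * h r3 = p * x + q * y + r * z" (is "?l = ?r")
proof -
  let ?D = "(r1 - r2) * (r1 - r3) * (r2 - r3)"
  have ne: "r1 - r2 \<noteq> 0" "r1 - r3 \<noteq> 0" "r2 - r3 \<noteq> 0"
    "r2 - r1 \<noteq> 0" "r3 - r1 \<noteq> 0" "r3 - r2 \<noteq> 0"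
    using distinct_roots by auto
  \<comment> \<open>At a root t, the quadratic factor of p is the product of the other two roots and
    t + a - 1 is minus their sum.\<close>
  have d: "d r1 = p * (r2 * r3) - q * (r2 + r3) + r" "d r2 = p * (r1 * r3) - q * (r1 + r3) + r"
    "d r3 = p * (r1 * r2) - q * (r1 + r2) + r"
    unfolding d_def using vieta by algebra+
  have "d r1 / ((r1 - r2) * (r1 - r3)) = d r1 * (r2 - r3) / ?D"
    "d r2 / ((r2 - r1) * (r2 - r3)) = - d r2 * (r1 - r3) / ?D"
    "d r3 / ((r3 - r1) * (r3 - r2)) = d r3 * (r1 - r2) / ?D"
    using ne by (simp_all add: divide_simps) (simp_all add: algebra_simps)
  moreover have "u / D * l + v / D * m + w / D * n = (u * l + v * m + w * n) / D"
    for u v w l m n D :: real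
    by (simp add: add_divide_distrib)
  ultimately have "?l = (d r1 * (r2 - r3) * h r1 + - d r2 * (r1 - r3) * h r2
      + d r3 * (r1 - r2) * h r3) / ?D"
    by (simp only:)
  also have "d r1 * (r2 - r3) * h r1 + - d r2 * (r1 - r3) * h r2 + d r3 * (r1 - r2) * h r3 = ?r * ?D"
    unfolding d h_def by algebra
  finally show ?thesis using ne by simp
qed

text \<open>The form is the trace of the given element times d/f'. The signs required of d are those
  of f' at the three roots, so this trace is a sum of positive terms.\<close>

lemma dual_positive:
  fixes p q r x y z :: int
  defines "d t \<equiv> of_int p * (t\<^sup>2 + (of_int a - 1) * t - of_int a) + of_int q * (t + of_int a - 1)
    + (of_int r :: real)"
  assumes d: "d r1 > 0" "d r2 < 0" "d r3 > 0" and tp: "totally_positive K (icomb \<rho> x y z)"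
  shows "p * x + q * y + r * z > 0"
proof -
  have h: "0 < of_int x + of_int y * t + of_int z * t\<^sup>2" if "ennola a t = 0" for t :: real
  proof -
    have "0 < icomb t x y z"
      using tp that real_root_iff by (auto simp: totally_positive_iff emb_icomb)
    then show ?thesis by (simp add: icomb_def)
  qed
  have "(r1 - r2) * (r1 - r3) > 0" "(r2 - r1) * (r2 - r3) < 0" "(r3 - r1) * (r3 - r2) > 0"
    using distinct_roots by (auto intro: mult_pos_pos mult_neg_neg simp: mult_less_0_iff)
  then have "d r1 / ((r1 - r2) * (r1 - r3)) > 0" "d r2 / ((r2 - r1) * (r2 - r3)) > 0"
    "d r3 / ((r3 - r1) * (r3 - r2)) > 0"
    using d by (auto intro: divide_pos_pos divide_neg_neg)
  then have "0 < real_of_int p * x + real_of_int q * y + real_of_int r * z"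
    unfolding dual_basis[of p q r x y z, folded d_def, symmetric]
    by (intro add_pos_pos mult_pos_pos h real_roots) auto
  also have "\<dots> = real_of_int (p * x + q * y + r * z)" by simp
  finally show ?thesis by (simp only: of_int_0_less_iff)
qed

text \<open>\<open>a\<close> times the linear functionals that are 1 on the generators of the first and of the second
  cone, respectively.\<close>

definition L1 :: "int \<Rightarrow> int \<Rightarrow> int \<Rightarrow> int" where
  "L1 x y z = a * (x + z)"

definition L2 :: "int \<Rightarrow> int \<Rightarrow> int \<Rightarrow> int" where
  "L2 x y z = a * x + (a - 1) * y + (2 * a - 1) * z"

lemma small_roots: "r2 > -1" "r3 < -1"
proof -
  have "- 1 / real_of_int a \<ge> - 1 / 3" using a3 by simp
  then show "r2 > -1" "r3 < -1" using bounds a3 by linarith+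
qed

text \<open>Here d(t) = (t + 1)/t, whose signs follow from r1 > 1, -1 < r2 < 0 and r3 < -1.\<close>

lemma L1_positive:
  assumes "totally_positive K (icomb \<rho> x y z)"
  shows "L1 x y z > 0"
proof -
  let ?d = "\<lambda>t::real. of_int 1 * (t\<^sup>2 + (of_int a - 1) * t - of_int a)
    + of_int 0 * (t + of_int a - 1) + of_int 1"
  have d: "?d t = (t + 1) / t" if "ennola a t = 0" "t \<noteq> 0" for t
  proof -
    have "?d t * t = t + 1" using that unfolding ennola_def by simp algebra
    then show ?thesis using that by (simp add: field_simps)
  qed
  have "?d r1 > 0" "?d r2 < 0" "?d r3 > 0"
    using bounds small_roots d[OF real_roots(1)] d[OF real_roots(2)] d[OF real_roots(3)]
    by (auto simp: zero_less_divide_iff divide_less_0_iff)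
  from dual_positive[OF this assms] show ?thesis using a3 by (simp add: L1_def)
qed

lemma L2_positive:
  assumes "totally_positive K (icomb \<rho> x y z)"
  shows "L2 x y z > 0"
proof -
  define A where "A = real_of_int a"
  have A: "A \<ge> 3" using a3 by (simp add: A_def)
  let ?d = "\<lambda>t::real. of_int a * (t\<^sup>2 + (of_int a - 1) * t - of_int a)
    + of_int (a - 1) * (t + of_int a - 1) + of_int (2 * a - 1)"
  have d: "?d t = (A + A\<^sup>2 * t + (A - 1) * t\<^sup>2) / t" if "ennola a t = 0" "t \<noteq> 0" for t
  proof -
    have "?d t * t = A + A\<^sup>2 * t + (A - 1) * t\<^sup>2"
      using that unfolding ennola_def A_def by simp algebra
    then show ?thesis using that by (simp add: field_simps)
  qed
  have 1: "A + A\<^sup>2 * r1 + (A - 1) * r1\<^sup>2 > 0"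
    using bounds A by (intro add_pos_pos mult_pos_pos) auto
  have "A * r2 > -1" using bounds(2) A by (simp add: A_def field_simps)
  then have "A * (1 + A * r2) > 0" using A by simp
  then have "A + A\<^sup>2 * r2 > 0" by (simp add: algebra_simps power2_eq_square)
  then have 2: "A + A\<^sup>2 * r2 + (A - 1) * r2\<^sup>2 > 0"
    by (rule add_pos_nonneg) (use A in simp)
  \<comment> \<open>Between -A and 1 - A the convex quadratic lies below its chord, which has slope
    -(A^2 - 3 A + 1) < 0 and the negative value A - A^2 at -A.\<close>
  have "(r3 + A) * (r3 + A - 1) < 0"
    using bounds by (intro mult_pos_neg) (auto simp: A_def)
  then have "(A - 1) * r3\<^sup>2 < (A - 1) * (- (2 * A - 1) * r3 - A * (A - 1))"
    using A by (intro mult_strict_left_mono) (auto simp: algebra_simps power2_eq_square)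
  moreover have "(A\<^sup>2 - 3 * A + 1) * (r3 + A) > 0"
  proof (rule mult_pos_pos)
    show "A\<^sup>2 - 3 * A + 1 > 0" using mult_right_mono[of 3 A A] A unfolding power2_eq_square by linarith
  qed (use bounds in \<open>simp add: A_def\<close>)
  moreover have "A < A * A" using A by simp
  ultimately have 3: "A + A\<^sup>2 * r3 + (A - 1) * r3\<^sup>2 < 0"
    by (simp add: algebra_simps power2_eq_square)
  have "?d r1 > 0" "?d r2 < 0" "?d r3 > 0"
    using bounds small_roots d[OF real_roots(1)] d[OF real_roots(2)] d[OF real_roots(3)] 1 2 3
    by (auto simp: zero_less_divide_iff divide_less_0_iff)
  from dual_positive[OF this assms] show ?thesis by (simp add: L2_def)
qed

section \<open>Totally positive units\<close>

text \<open>A totally positive unit is carried along with its inverse, so that inverting is a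
  swap.\<close>

definition unit_pair :: "complex \<Rightarrow> complex \<Rightarrow> bool" where
  "unit_pair u v \<longleftrightarrow> u \<in> R \<and> v \<in> R \<and> totally_positive K u \<and> totally_positive K v \<and> u * v = 1"

lemma unit_pair_commute: "unit_pair u v \<Longrightarrow> unit_pair v u"
  by (auto simp: unit_pair_def mult.commute)

lemma unit_pair_mult: "unit_pair u v \<Longrightarrow> unit_pair u' v' \<Longrightarrow> unit_pair (u * u') (v * v')"
  unfolding unit_pair_def using R_mult totally_positive_mult
  by (metis mult.assoc mult.commute mult.right_neutral)

lemma icomb_1: "icomb t 1 0 0 = 1" by (simp add: icomb_def)

lemma unit_pair_icombI:
  assumes "\<And>t. ennola a t = 0 \<Longrightarrow> 0 < (icomb t x y z :: real)"
    and "icomb \<rho> x y z * icomb \<rho> x' y' z' = icomb \<rho> 1 0 0"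
  shows "unit_pair (icomb \<rho> x y z) (icomb \<rho> x' y' z')"
proof -
  have "totally_positive K (icomb \<rho> x y z)"
    using assms(1) real_roots icomb_in_R R_subset_K by (auto simp: totally_positive_iff emb_icomb)
  then show ?thesis
    using assms(2)[unfolded icomb_1] totally_positive_inverse icomb_in_R R_subset_K
    unfolding unit_pair_def by blast
qed

text \<open>In order: \<rho>^2; \<rho>^2 (\<rho> + a), the inverse of \<open>e\<^sub>3\<close>; and
  \<rho> + a, the inverse of \<open>e\<^sub>2\<close>. They are positive at every root because the
  roots are nonzero and exceed -a.\<close>

lemma unit_pairs:
  "unit_pair (icomb \<rho> 0 0 1) (icomb \<rho> (a\<^sup>2 + a - 1) (1 - a\<^sup>2 + a) (- a))"
  "unit_pair (icomb \<rho> 1 a 1) (icomb \<rho> (a + 1) (1 - a) (- 1))"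
  "unit_pair (icomb \<rho> a 1 0) (icomb \<rho> 0 (- 1) 1)"
proof -
  have pos: "t \<noteq> 0" "t + of_int a > 0" if "ennola a t = 0" for t :: real
    using that bounds small_roots a3 by (auto simp: real_root_iff)
  show "unit_pair (icomb \<rho> 0 0 1) (icomb \<rho> (a\<^sup>2 + a - 1) (1 - a\<^sup>2 + a) (- a))"
  proof (rule unit_pair_icombI)
    show "icomb \<rho> 0 0 1 * icomb \<rho> (a\<^sup>2 + a - 1) (1 - a\<^sup>2 + a) (- a) = icomb \<rho> 1 0 0"
      unfolding icomb_mult[OF root] by (simp add: algebra_simps power2_eq_square)
  qed (use pos in \<open>simp add: icomb_def\<close>)
  show "unit_pair (icomb \<rho> a 1 0) (icomb \<rho> 0 (- 1) 1)"
  proof (rule unit_pair_icombI)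
    show "icomb \<rho> a 1 0 * icomb \<rho> 0 (- 1) 1 = icomb \<rho> 1 0 0"
      unfolding icomb_mult[OF root] by simp
  qed (use pos in \<open>simp add: icomb_def add.commute\<close>)
  show "unit_pair (icomb \<rho> 1 a 1) (icomb \<rho> (a + 1) (1 - a) (- 1))"
  proof (rule unit_pair_icombI)
    show "icomb \<rho> 1 a 1 * icomb \<rho> (a + 1) (1 - a) (- 1) = icomb \<rho> 1 0 0"
      unfolding icomb_mult[OF root] by (simp add: algebra_simps power2_eq_square)
    fix t :: real assume t: "ennola a t = 0"
    then have "icomb t 1 a 1 = t\<^sup>2 * (t + of_int a)"
      unfolding ennola_def icomb_def by simp algebra
    then show "0 < icomb t 1 a 1" using pos[OF t] by simp
  qed
qed

text \<open>The inequalities say that the coordinates with respect to the generators are nonnegative: up to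
  the factor \<open>a\<close> in the second cone, these are \<open>x, y + z, - y\<close> for \<open>1, \<rho>\<^sup>2, e\<^sub>2\<close>, and
  \<open>a x + (a + 1) (y + z), a z - (y + z), - (y + z)\<close> for \<open>1, e\<^sub>2, e\<^sub>3\<close>.\<close>

definition cone1 :: "int \<Rightarrow> int \<Rightarrow> int \<Rightarrow> bool" where
  "cone1 x y z \<longleftrightarrow> 0 \<le> x \<and> y \<le> 0 \<and> 0 \<le> y + z"

definition cone2 :: "int \<Rightarrow> int \<Rightarrow> int \<Rightarrow> bool" where
  "cone2 x y z \<longleftrightarrow> y + z \<le> 0 \<and> y + z \<le> a * z \<and> 0 \<le> a * x + (a + 1) * (y + z)"

lemma cone_reduction:
  assumes R: "\<alpha> \<in> R" and tp: "totally_positive K \<alpha>"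
  obtains u v x y z where "unit_pair u v" "\<alpha> * u = icomb \<rho> x y z" "cone1 x y z \<or> cone2 x y z"
proof -
  define Orb where "Orb = (\<lambda>(x, y, z). \<exists>u v. unit_pair u v \<and> \<alpha> * u = icomb \<rho> x y z)"
  have mult: "Orb (x * p + (y * r + z * q) - (a - 1) * (z * r),
      x * q + y * p + a * (y * r + z * q) + (1 - a * (a - 1)) * (z * r),
      x * r + y * q + z * p - (a - 1) * (y * r + z * q) + (a + (a - 1)\<^sup>2) * (z * r))"
    if "Orb (x, y, z)" "unit_pair (icomb \<rho> p q r) v" for x y z p q r v
    using that unit_pair_mult unfolding Orb_def prod.case
    by (metis icomb_mult[OF root] mult.assoc)
  have pos: "L1 x y z > 0" "L2 x y z > 0" if "Orb (x, y, z)" for x y z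
  proof -
    from that obtain u v where "unit_pair u v" "\<alpha> * u = icomb \<rho> x y z"
      by (auto simp: Orb_def)
    then have "totally_positive K (icomb \<rho> x y z)"
      using totally_positive_mult[OF tp] unfolding unit_pair_def by metis
    then show "L1 x y z > 0" "L2 x y z > 0" by (fact L1_positive, fact L2_positive)
  qed
  obtain x0 y0 z0 where "\<alpha> = icomb \<rho> x0 y0 z0" using R unfolding R_eq by blast
  moreover have "unit_pair 1 1"
    using icomb_in_R[of 1 0 0] R_subset_K
    by (auto simp: unit_pair_def icomb_1 totally_positive_iff emb_1)
  ultimately have "Orb (x0, y0, z0)" unfolding Orb_def prod.case by (metis mult.right_neutral)
  \<comment> \<open>Both functionals are positive on the orbit of \<alpha>, so \<open>nat\<close>
    loses nothing and a minimum exists.\<close>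
  define m where "m = (\<lambda>(x, y, z). nat (min (L1 x y z) (L2 x y z)))"
  obtain w where w: "Orb w" and min: "\<forall>w'. Orb w' \<longrightarrow> m w \<le> m w'"
    using ex_has_least_nat[of Orb _ m, OF \<open>Orb (x0, y0, z0)\<close>] by blast
  obtain x y z where xyz: "w = (x, y, z)" by (cases w)
  have Orb: "Orb (x, y, z)" using w by (simp add: xyz)
  define N1 where "N1 p q r = L1 (x * p + (y * r + z * q) - (a - 1) * (z * r))
      (x * q + y * p + a * (y * r + z * q) + (1 - a * (a - 1)) * (z * r))
      (x * r + y * q + z * p - (a - 1) * (y * r + z * q) + (a + (a - 1)\<^sup>2) * (z * r))" for p q r
  define N2 where "N2 p q r = L2 (x * p + (y * r + z * q) - (a - 1) * (z * r))
      (x * q + y * p + a * (y * r + z * q) + (1 - a * (a - 1)) * (z * r))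
      (x * r + y * q + z * p - (a - 1) * (y * r + z * q) + (a + (a - 1)\<^sup>2) * (z * r))" for p q r
  have min': "min (L1 x y z) (L2 x y z) \<le> N1 p q r" "min (L1 x y z) (L2 x y z) \<le> N2 p q r"
    if "unit_pair (icomb \<rho> p q r) v" for p q r v
    using min[rule_format, OF mult[OF Orb that]] pos[OF mult[OF Orb that]]
    unfolding N1_def N2_def m_def xyz prod.case by linarith+
  note m1 = min'[OF unit_pairs(1)] and m2 = min'[OF unit_pairs(2)]
    and m1' = min'[OF unit_pairs(1)[THEN unit_pair_commute]]
    and m2' = min'[OF unit_pairs(2)[THEN unit_pair_commute]]
  have aa: "a * a - a - 1 > 0"
    using mult_mono[of 3 a 2 "a - 1"] a3 by (simp add: algebra_simps)
  have cancel: "0 \<le> t" if "0 \<le> c * t" "c > 0" for c t :: int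
    using that by (simp add: zero_le_mult_iff)
  \<comment> \<open>Each identity compares the functionals of two cones sharing a facet: they differ
    by a positive multiple of the coordinate opposite to that facet. Minimality makes this
    coordinate nonnegative.\<close>
  have eqs: "N2 (a + 1) (1 - a) (- 1) = L1 x y z - y"
    "N2 (a\<^sup>2 + a - 1) (1 - a\<^sup>2 + a) (- a) = L1 x y z + (a * a - a - 1) * x"
    "N1 1 a 1 = L2 x y z + (a * x + (a + 1) * (y + z))"
    "N1 0 0 1 = L2 x y z + (a * a - a - 1) * (a * z - (y + z))"
    "L2 x y z = L1 x y z + (a - 1) * (y + z)"
    unfolding N1_def N2_def L1_def L2_def by algebra+
  have "cone1 x y z \<or> cone2 x y z"
  proof (cases "L1 x y z \<le> L2 x y z")
    case True
    then have "0 \<le> (a - 1) * (y + z)" using eqs(5) by linarith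
    moreover have "0 \<le> - y" using True m2'(2) eqs(1) by linarith
    moreover have "0 \<le> (a * a - a - 1) * x" using True m1'(2) eqs(2) by linarith
    ultimately have "cone1 x y z"
      using a3 aa cancel[of "a - 1" "y + z"] cancel[of "a * a - a - 1" x] by (simp add: cone1_def)
    then show ?thesis ..
  next
    case False
    then have "(a - 1) * (y + z) \<le> 0" using eqs(5) by linarith
    then have "0 \<le> (a - 1) * - (y + z)" by (simp only: mult_minus_right)
    moreover have "0 \<le> a * x + (a + 1) * (y + z)" using False m2(1) eqs(3) by linarith
    moreover have "0 \<le> (a * a - a - 1) * (a * z - (y + z))"
      using False m1(1) eqs(4) by linarith
    ultimately have "cone2 x y z"
      using a3 aa cancel[of "a - 1" "- (y + z)"] cancel[of "a * a - a - 1" "a * z - (y + z)"]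
      by (simp add: cone2_def)
    then show ?thesis ..
  qed
  with Orb that show ?thesis by (auto simp: Orb_def)
qed

lemma cone1_totally_positive:
  assumes c: "cone1 x y z" and ne: "(x, y, z) \<noteq> (0, 0, 0)"
  shows "totally_positive K (icomb \<rho> x y z)"
proof -
  have "0 < icomb t x y z" if t: "ennola a t = 0" for t :: real
  proof -
    have e: "icomb t 0 0 1 > 0" "icomb t 0 (-1) 1 > 0"
      using unit_pairs t real_root_iff by (auto simp: unit_pair_def totally_positive_iff emb_icomb)
    have "0 < of_int x * 1 + of_int (y + z) * icomb t 0 0 1 + of_int (- y) * icomb t 0 (-1) 1"
      using c ne e by (intro combination_positive) (auto simp: cone1_def)
    also have "\<dots> = icomb t x y z" by (simp add: icomb_def algebra_simps)
    finally show ?thesis .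
  qed
  then show ?thesis
    using real_roots icomb_in_R R_subset_K by (auto simp: totally_positive_iff emb_icomb)
qed


text \<open>The generators span a sublattice of index a, so the integral combination is formed for a
  times the element.\<close>

lemma cone2_totally_positive:
  assumes c: "cone2 x y z" and ne: "(x, y, z) \<noteq> (0, 0, 0)"
  shows "totally_positive K (icomb \<rho> x y z)"
proof -
  have "0 < icomb t x y z" if t: "ennola a t = 0" for t :: real
  proof -
    have e: "icomb t 0 (-1) 1 > 0" "icomb t (a + 1) (1 - a) (-1) > 0"
      using unit_pairs t real_root_iff by (auto simp: unit_pair_def totally_positive_iff emb_icomb)
    have "0 < a * x + (a + 1) * (y + z) \<or> 0 < a * z - (y + z) \<or> 0 < - (y + z)"
    proof (rule ccontr)
      assume "\<not> ?thesis"
      then have "y + z = 0" "a * z = 0" "a * x + (a + 1) * (y + z) = 0"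
        using c unfolding cone2_def by linarith+
      then show False using a3 ne by simp
    qed
    then have "0 < of_int (a * x + (a + 1) * (y + z)) * 1 + of_int (a * z - (y + z)) * icomb t 0 (-1) 1
        + of_int (- (y + z)) * icomb t (a + 1) (1 - a) (-1)"
      using c e by (intro combination_positive) (auto simp: cone2_def)
    also have "\<dots> = of_int a * icomb t x y z" by (simp add: icomb_def algebra_simps)
    finally show ?thesis using a3 by (simp add: zero_less_mult_iff)
  qed
  then show ?thesis
    using real_roots icomb_in_R R_subset_K by (auto simp: totally_positive_iff emb_icomb)
qed

subsection \<open>Indecomposables and minimal traces\<close>

lemma icomb_0_not_totally_positive: "\<not> totally_positive K (icomb \<rho> 0 0 0)"
  by (simp add: totally_positive_iff emb_icomb) (simp add: icomb_def)

text \<open>A totally positive unit \<open>p + q \<rho> + r \<rho>\<^sup>2\<close> can be split off as soon as the difference stays in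
  the same cone.\<close>

lemma unit_if_indecomposable:
  assumes ind: "indecomposable K R (icomb \<rho> x y z)" and u: "unit_pair (icomb \<rho> p q r) v"
    and diff: "cone1 (x - p) (y - q) (z - r) \<or> cone2 (x - p) (y - q) (z - r)"
  shows "is_unit_in R (icomb \<rho> x y z)"
proof (cases "(x - p, y - q, z - r) = (0, 0, 0)")
  case True
  then have "x = p" "y = q" "z = r" by auto
  with u show ?thesis by (auto simp: unit_pair_def is_unit_in_def)
next
  case False
  then have "totally_positive K (icomb \<rho> (x - p) (y - q) (z - r))"
    using diff cone1_totally_positive cone2_totally_positive by blast
  moreover have "icomb \<rho> x y z = icomb \<rho> p q r + icomb \<rho> (x - p) (y - q) (z - r)"
    by (simp add: icomb_def algebra_simps)
  ultimately show ?thesis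
    using ind u icomb_in_R unfolding indecomposable_def unit_pair_def by blast
qed

lemma unit_pair_1: "unit_pair (icomb \<rho> 1 0 0) (icomb \<rho> 1 0 0)"
  using icomb_in_R[of 1 0 0] R_subset_K
  by (auto simp: unit_pair_def icomb_1 totally_positive_iff emb_1)

text \<open>The generators form a lattice basis, so a nonzero element has a coordinate at least 1,
  and the corresponding generator can be split off.\<close>

lemma cone1_indecomposable:
  assumes ind: "indecomposable K R (icomb \<rho> x y z)" and c: "cone1 x y z"
  shows "is_unit_in R (icomb \<rho> x y z)"
proof -
  have "\<not> (x = 0 \<and> y = 0 \<and> z = 0)"
    using ind icomb_0_not_totally_positive by (auto simp: indecomposable_def)
  then consider "x \<ge> 1" | "y \<le> -1" | "y + z \<ge> 1" using c by (fastforce simp: cone1_def)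
  then show ?thesis
  proof cases
    case 1
    with c show ?thesis by (intro unit_if_indecomposable[OF ind unit_pair_1]) (simp add: cone1_def)
  next
    case 2
    with c show ?thesis
      by (intro unit_if_indecomposable[OF ind unit_pair_commute[OF unit_pairs(3)]])
        (simp add: cone1_def)
  next
    case 3
    with c show ?thesis
      by (intro unit_if_indecomposable[OF ind unit_pairs(1)]) (simp add: cone1_def)
  qed
qed

text \<open>Since no generator can be split off, the coordinates scaled by a all lie in [0, a). The
  lattice points of this half-open parallelepiped are 0 and the 1 + k (1 - \<rho>).\<close>

lemma cone2_indecomposable:
  assumes ind: "indecomposable K R (icomb \<rho> x y z)" and c: "cone2 x y z"
    and nu: "\<not> is_unit_in R (icomb \<rho> x y z)"
  obtains k where "1 \<le> k" "k < a" "x = 1 + k" "y = - k" "z = 0"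
proof -
  have n1: "a * x + (a + 1) * (y + z) < a"
  proof (rule ccontr)
    assume "\<not> ?thesis"
    with c have "cone2 (x - 1) (y - 0) (z - 0)" by (simp add: cone2_def algebra_simps)
    with unit_if_indecomposable[OF ind unit_pair_1] nu show False by blast
  qed
  have n2: "a * z - (y + z) < a"
  proof (rule ccontr)
    assume "\<not> ?thesis"
    with c have "cone2 (x - 0) (y - - 1) (z - 1)" by (simp add: cone2_def algebra_simps)
    with unit_if_indecomposable[OF ind unit_pair_commute[OF unit_pairs(3)]] nu show False by blast
  qed
  have n3: "- (y + z) < a"
  proof (rule ccontr)
    assume "\<not> ?thesis"
    with c have "cone2 (x - (a + 1)) (y - (1 - a)) (z - - 1)"
      by (simp add: cone2_def algebra_simps)
    with unit_if_indecomposable[OF ind unit_pair_commute[OF unit_pairs(2)]] nu show False by blast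
  qed
  have "a * z < a * 1" "a * (- 1) < a * z" using c n2 n3 unfolding cone2_def by linarith+
  then have z: "z = 0" using a3 by (simp only: mult_less_cancel_left_pos)
  define k where "k = - y"
  have k: "0 \<le> k" "k < a" using c n3 by (simp_all add: cone2_def z k_def)
  \<comment> \<open>With z = 0 the scaled coordinates are a (x - k) - k, k and k. Hence x - k is 0
    or 1, and the value 0 forces k = 0, that is, the zero element.\<close>
  have x: "0 \<le> a * (x - k) - k" "a * (x - k) - k < a"
    using c n1 by (simp_all add: cone2_def z k_def algebra_simps)
  have "a * (x - k) < a * 2" "a * (- 1) < a * (x - k)" using x k by linarith+
  then have "x - k < 2" "- 1 < x - k" using a3 by (simp_all only: mult_less_cancel_left_pos)
  then consider "x - k = 0" | "x - k = 1" by linarith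
  then show ?thesis
  proof cases
    case 1
    then have "x = 0" "y = 0" using x(1) k by (auto simp: k_def)
    with z ind icomb_0_not_totally_positive show ?thesis by (auto simp: indecomposable_def)
  next
    case 2
    have "k \<noteq> 0"
    proof
      assume "k = 0"
      with 2 x(2) show False by simp
    qed
    with k 2 show ?thesis by (intro that[of k]) (auto simp: z k_def)
  qed
qed

section \<open>Traces against the codifferent\<close>

lemma field_trace_add: "s \<in> K \<Longrightarrow> s' \<in> K \<Longrightarrow> field_trace K (s + s') = field_trace K s + field_trace K s'"
proof -
  assume "s \<in> K" "s' \<in> K"
  then obtain x y z x' y' z' where "s = rcomb \<rho> x y z" "s' = rcomb \<rho> x' y' z'"
    unfolding K_eq by blast
  then show ?thesis by (simp add: rcomb_add field_trace_rcomb algebra_simps)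
qed

lemma field_trace_of_int_mult: "s \<in> K \<Longrightarrow> field_trace K (of_int n * s) = of_int n * field_trace K s"
proof -
  assume "s \<in> K"
  then obtain x y z where s: "s = rcomb \<rho> x y z" unfolding K_eq by blast
  have "of_int n * s = rcomb \<rho> (of_int n * x) (of_int n * y) (of_int n * z)"
    by (simp add: s rcomb_def of_rat_mult algebra_simps)
  then show ?thesis by (simp add: s field_trace_rcomb algebra_simps)
qed

text \<open>The trace is a sum of positive conjugates and, by the definition of the codifferent, an
  integer.\<close>

lemma field_trace_totally_positive:
  assumes "s \<in> R" "totally_positive K s" "\<delta> \<in> codifferent K R" "totally_positive K \<delta>"
  shows "1 \<le> field_trace K (s * \<delta>)"
proof -
  have tp: "totally_positive K (s * \<delta>)" using assms totally_positive_mult by blast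
  then have "0 < real_of_rat (field_trace K (s * \<delta>))"
    by (subst field_trace_eq) (auto simp: totally_positive_iff)
  moreover obtain m where "field_trace K (s * \<delta>) = of_int m"
    using assms unfolding codifferent_def Ints_def by blast
  ultimately show ?thesis by simp
qed

lemma codifferent_mult:
  assumes "\<delta> \<in> codifferent K R" "u \<in> R"
  shows "u * \<delta> \<in> codifferent K R"
  using assms R_subset_K R_mult unfolding codifferent_def
  by (auto simp: mult.assoc[symmetric] subset_eq)

lemma codifferent_element:
  obtains \<delta> where "\<delta> \<in> codifferent K R" "totally_positive K \<delta>"
    "\<forall>x y z. field_trace K (icomb \<rho> x y z * \<delta>) = of_int (2 * x + 2 * y + 3 * z)"
proof -
  \<comment> \<open>The value f'(\<rho>); the numerator below is (\<rho> + 1)/(\<rho> - 1) in the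
    power basis.\<close>
  define f' where "f' = icomb \<rho> (- a) (2 * (a - 1)) 3"
  define \<delta> where "\<delta> = icomb \<rho> 1 (2 * a) 2 * inverse f'"
  have f'K: "f' \<in> K" and gK: "icomb \<rho> 1 (2 * a) 2 \<in> K"
    using icomb_in_R R_subset_K by (auto simp: f'_def)
  have \<delta>K: "\<delta> \<in> K" unfolding \<delta>_def using f'K gK by blast
  have embf': "emb r1 f' = (r1 - r2) * (r1 - r3)" "emb r2 f' = (r2 - r1) * (r2 - r3)"
    "emb r3 f' = (r3 - r1) * (r3 - r2)"
    unfolding f'_def emb_icomb unfolding icomb_def of_int_mult of_int_diff of_int_minus of_int_1 of_int_numeral
    using vieta by algebra+
  then have "emb r1 f' > 0" using distinct_roots by simp
  then have "f' \<noteq> 0" using emb_icomb[of r1 0 0 0] by (auto simp: icomb_def)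
  then have "\<delta> * f' = icomb \<rho> 1 (2 * a) 2" by (simp add: \<delta>_def)
  then have prod: "emb t \<delta> * emb t f' = icomb t 1 (2 * a) 2" if "ennola a t = 0" for t
    using emb_mult[OF that \<delta>K f'K] by (simp add: emb_icomb)
  have "emb r1 \<delta> = icomb r1 1 (2 * a) 2 / emb r1 f'"
    "emb r2 \<delta> = icomb r2 1 (2 * a) 2 / emb r2 f'" "emb r3 \<delta> = icomb r3 1 (2 * a) 2 / emb r3 f'"
    using prod[OF real_roots(1)] prod[OF real_roots(2)] prod[OF real_roots(3)] distinct_roots
    unfolding embf' by (simp_all add: eq_divide_eq)
  note emb = this[unfolded embf']
  have num: "icomb t 1 (2 * a) 2 = (t + 1) / (t - 1)" if "ennola a t = 0" "t \<noteq> 1" for t :: real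
  proof -
    have "icomb t 1 (2 * a) 2 * (t - 1) = t + 1"
      using that unfolding ennola_def icomb_def by simp algebra
    then show ?thesis using that by (simp add: eq_divide_eq)
  qed
  have "icomb r1 1 (2 * a) 2 > 0" "icomb r2 1 (2 * a) 2 < 0" "icomb r3 1 (2 * a) 2 > 0"
    using bounds small_roots num[OF real_roots(1)] num[OF real_roots(2)] num[OF real_roots(3)]
    by (auto simp: zero_less_divide_iff divide_less_0_iff)
  moreover have "(r1 - r2) * (r1 - r3) > 0" "(r2 - r1) * (r2 - r3) < 0" "(r3 - r1) * (r3 - r2) > 0"
    using distinct_roots by (auto intro: mult_pos_pos mult_neg_neg simp: mult_less_0_iff)
  ultimately have tp: "totally_positive K \<delta>"
    using \<delta>K unfolding totally_positive_iff emb by (auto intro: divide_pos_pos divide_neg_neg)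
  have tr: "field_trace K (icomb \<rho> x y z * \<delta>) = of_int (2 * x + 2 * y + 3 * z)" for x y z
  proof -
    have sK: "icomb \<rho> x y z \<in> K" using icomb_in_R R_subset_K by blast
    \<comment> \<open>In the dual basis the element has coefficients 2, 2, 3, which are therefore
      its traces against 1, \<rho>, \<rho>^2.\<close>
    have d: "icomb t 1 (2 * a) 2 = 2 * (t\<^sup>2 + (of_int a - 1) * t - of_int a) + 2 * (t + of_int a - 1) + 3"
      for t :: real by (simp add: icomb_def algebra_simps)
    have "real_of_rat (field_trace K (icomb \<rho> x y z * \<delta>))
        = icomb r1 x y z * emb r1 \<delta> + icomb r2 x y z * emb r2 \<delta> + icomb r3 x y z * emb r3 \<delta>"
      using sK \<delta>K real_roots by (subst field_trace_eq) (auto simp: emb_mult emb_icomb)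
    also have "\<dots> = 2 * of_int x + 2 * of_int y + 3 * of_int z"
      unfolding dual_basis[of 2 2 3 "of_int x" "of_int y" "of_int z", symmetric] emb d
      unfolding icomb_def by (simp add: mult.commute)
    also have "\<dots> = real_of_rat (of_int (2 * x + 2 * y + 3 * z))"
      by (simp only: of_rat_of_int_eq)
    finally show ?thesis by (simp only: of_rat_eq_iff)
  qed
  then have "\<delta> \<in> codifferent K R" using \<delta>K unfolding codifferent_def R_eq by auto
  with tp tr that show ?thesis by blast
qed

lemma field_trace_lower_bound:
  assumes k: "1 \<le> k" "k < a" and \<delta>: "\<delta> \<in> codifferent K R" "totally_positive K \<delta>"
  shows "2 \<le> field_trace K (icomb \<rho> (1 + k) (- k) 0 * \<delta>)"
proof -
  let ?Tr = "\<lambda>s. field_trace K (s * \<delta>)"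
  let ?e2 = "icomb \<rho> 0 (- 1) 1" and ?e3 = "icomb \<rho> (a + 1) (1 - a) (- 1)"
  have \<delta>K: "\<delta> \<in> K" using \<delta> by (simp add: codifferent_def)
  have sK: "icomb \<rho> x y z * \<delta> \<in> K" for x y z using icomb_in_R R_subset_K \<delta>K by blast
  \<comment> \<open>The scaled coordinates of 1 + k (1 - \<rho>) in the second cone are a - k, k, k.
    Their sum a + k exceeds a, which pushes the integral trace above 1.\<close>
  have "of_int a * (icomb \<rho> (1 + k) (- k) 0 * \<delta>) =
      of_int (a - k) * (icomb \<rho> 1 0 0 * \<delta>) + (of_int k * (?e2 * \<delta>) + of_int k * (?e3 * \<delta>))"
    by (simp add: icomb_def algebra_simps)
  moreover have "of_int n * (icomb \<rho> x y z * \<delta>) \<in> K" for n x y z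
    using sK K_closed(5)[of "of_int n"] by auto
  ultimately have "of_int a * ?Tr (icomb \<rho> (1 + k) (- k) 0) =
      of_int (a - k) * ?Tr (icomb \<rho> 1 0 0) + (of_int k * ?Tr ?e2 + of_int k * ?Tr ?e3)"
    using sK by (simp only: field_trace_of_int_mult[symmetric] field_trace_add[symmetric] K_closed(1))
  also have "\<dots> \<ge> of_int (a - k) * 1 + (of_int k * 1 + of_int k * 1)"
    using unit_pairs unit_pair_1 k \<delta>
    by (intro add_mono mult_left_mono field_trace_totally_positive) (auto simp: unit_pair_def)
  finally have "of_int a + of_int k \<le> of_int a * ?Tr (icomb \<rho> (1 + k) (- k) 0)"
    by simp
  moreover have "(0 :: rat) < of_int k" using k by simp
  ultimately have "of_int a * 1 < of_int a * ?Tr (icomb \<rho> (1 + k) (- k) 0)"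
    by linarith
  then have "1 < ?Tr (icomb \<rho> (1 + k) (- k) 0)" using a3
    by (simp only: mult_less_cancel_left_pos of_int_0_less_iff)
  moreover obtain m where "?Tr (icomb \<rho> (1 + k) (- k) 0) = of_int m"
    using icomb_in_R \<delta>(1) unfolding codifferent_def Ints_def by blast
  ultimately show ?thesis by simp
qed

text \<open>Multiplication by u preserves indecomposables and non-units, and multiplication by u or
  v preserves totally positive codifferent elements, so both bounds carry over from the cone
  representative to \<alpha>.\<close>

lemma min_trace_2:
  assumes ind: "indecomposable K R \<alpha>" and nu: "\<not> is_unit_in R \<alpha>"
  shows "is_minimum {field_trace K (\<alpha> * \<delta>) | \<delta>. \<delta> \<in> codifferent K R \<and> totally_positive K \<delta>} 2"
proof -
  have \<alpha>: "\<alpha> \<in> R" "totally_positive K \<alpha>" using ind by (auto simp: indecomposable_def)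
  from cone_reduction[OF \<alpha>] obtain u v x y z where uv: "unit_pair u v"
    and \<beta>: "\<alpha> * u = icomb \<rho> x y z" and c: "cone1 x y z \<or> cone2 x y z" by metis
  have u: "u \<in> R" "v \<in> R" "totally_positive K u" "totally_positive K v" "u * v = 1"
    using uv by (auto simp: unit_pair_def)
  have \<alpha>_eq: "\<alpha> = icomb \<rho> x y z * v" using u(5) by (simp add: \<beta>[symmetric] mult.assoc)
  have ind': "indecomposable K R (icomb \<rho> x y z)"
  proof -
    have False if "s \<in> R" "s' \<in> R" "totally_positive K s" "totally_positive K s'"
      "icomb \<rho> x y z = s + s'" for s s'
    proof -
      have "\<alpha> = s * v + s' * v" unfolding \<alpha>_eq that(5) by (rule distrib_right)
      then show False
        using ind that R_mult totally_positive_mult u unfolding indecomposable_def by metis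
    qed
    then show ?thesis
      using R_mult[OF \<alpha>(1) u(1)] totally_positive_mult[OF \<alpha>(2) u(3)]
      unfolding indecomposable_def \<beta> by blast
  qed
  have nu': "\<not> is_unit_in R (icomb \<rho> x y z)"
  proof
    assume "is_unit_in R (icomb \<rho> x y z)"
    then obtain w where w: "w \<in> R" "\<alpha> * u * w = 1" by (auto simp: is_unit_in_def \<beta>)
    then have "\<alpha> * (u * w) = 1" by (simp add: mult.assoc)
    with nu \<alpha> R_mult[OF u(1) w(1)] show False by (auto simp: is_unit_in_def)
  qed
  obtain k where k: "1 \<le> k" "k < a" "x = 1 + k" "y = - k" "z = 0"
    using c cone1_indecomposable[OF ind'] cone2_indecomposable[OF ind' _ nu'] nu' by metis
  show ?thesis
    unfolding is_minimum_def
  proof (intro conjI ballI)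
    obtain \<delta> where \<delta>: "\<delta> \<in> codifferent K R" "totally_positive K \<delta>"
      "\<forall>x y z. field_trace K (icomb \<rho> x y z * \<delta>) = of_int (2 * x + 2 * y + 3 * z)"
      by (rule codifferent_element)
    \<comment> \<open>The form 2 x + 2 y + 3 z takes the value 2 (1 + k) - 2 k = 2, whatever k
      is.\<close>
    have "field_trace K (\<alpha> * (u * \<delta>)) = 2"
      using \<delta>(3)[rule_format, of x y z] by (simp add: mult.assoc[symmetric] \<beta> k)
    then show "2 \<in> {field_trace K (\<alpha> * \<delta>) | \<delta>. \<delta> \<in> codifferent K R \<and> totally_positive K \<delta>}"
      using codifferent_mult[OF \<delta>(1) u(1)] totally_positive_mult[OF u(3) \<delta>(2)] by force
  next
    fix s assume "s \<in> {field_trace K (\<alpha> * \<delta>) | \<delta>. \<delta> \<in> codifferent K R \<and> totally_positive K \<delta>}"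
    then obtain \<delta> where s: "s = field_trace K (\<alpha> * \<delta>)"
      and \<delta>: "\<delta> \<in> codifferent K R" "totally_positive K \<delta>" by blast
    show "2 \<le> s"
      using field_trace_lower_bound[OF k(1,2) codifferent_mult[OF \<delta>(1) u(2)]
          totally_positive_mult[OF u(4) \<delta>(2)]]
      by (simp add: s \<alpha>_eq k mult.assoc)
  qed
qed

end

theorem proposition4p2:
  fixes a :: int and \<rho> \<alpha> :: complex and K R :: "complex set"
  defines "K \<equiv> rat_adjoin \<rho>" and "R \<equiv> int_adjoin \<rho>"
  assumes "a \<ge> 3"
    and "poly [:- 1, - of_int a, of_int (a - 1), 1:] \<rho> = 0"
    and "indecomposable K R \<alpha>"
    and "\<not> is_unit_in R \<alpha>"
  shows "is_minimum {field_trace K (\<alpha> * \<delta>) | \<delta>. \<delta> \<in> codifferent K R \<and> totally_positive K \<delta>} 2"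
proof -
  have "ennola a \<rho> = poly [:- 1, - of_int a, of_int (a - 1), 1:] \<rho>"
    by (simp add: ennola_def algebra_simps power2_eq_square power3_eq_cube)
  then have root: "ennola a \<rho> = 0" using assms by simp
  from ennola_real_roots[OF assms(3)] obtain r1 r2 r3 :: real where
    "ennola a r1 = 0" "ennola a r2 = 0" "ennola a r3 = 0"
    "1 < r1" "- 1 / of_int a < r2" "r2 < 0" "- of_int a < r3" "r3 < 1 - of_int a" .
  with assms(3) root interpret ennola_cubic a \<rho> r1 r2 r3 by unfold_locales
  show ?thesis using min_trace_2 assms unfolding K_def R_def by blast
qed

end
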